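(* Let $(C,\Delta_{-1},\Delta_1,\alpha)$ be a Hom-dendriform coalgebra. Define the linear map $\Delta=\Delta_1-\tau\circ\Delta_{-1}:C\to C\otimes C$. Then $(C,\Delta,\alpha)$ is a Hom-preLie coalgebra.
   Context: All vector spaces are over a field $\mathbb{F}$ of characteristic $0$; $I$ is the identity map and $\tau(x\otimes y)=y\otimes x$. A Hom-dendriform coalgebra $(C,\Delta_{-1},\Delta_1,\alpha)$ is a vector space $C$ with linear maps $\Delta_{-1},\Delta_1:C\to C\otimes C$ and $\alpha:C\to C$ such that $(\Delta_{-1}\otimes\alpha)\circ\Delta_{-1}=(\alpha\otimes\Delta_{-1}+\alpha\otimes\Delta_1)\circ\Delta_{-1}$, $(\Delta_1\otimes\alpha)\circ\Delta_{-1}=(\alpha\otimes\Delta_{-1})\circ\Delta_1$, $(\alpha\otimes\Delta_1)\circ\Delta_1=(\Delta_{-1}\otimes\alpha+\Delta_1\otimes\alpha)\circ\Delta_1$. A Hom-preLie coalgebra $(C,\Delta,\alpha)$ is a vector space $C$ with linear maps $\Delta:C\to C\otimes C$ and $\alpha:C\to C$ such that $(\Delta\otimes\alpha)\circ\Delta-(\alpha\otimes\Delta)\circ\Delta=(\tau\otimes I)\circ\big((\Delta\otimes\alpha)\circ\Delta-(\alpha\otimes\Delta)\circ\Delta\big)$. *)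

theory Defs
  imports "HOL-Algebra.Module" "HOL-Algebra.AbelCoset"
begin

section \<open>Linear maps, free modules, quotient modules\<close>

definition linear_maps ::
    "('r, 'x) ring_scheme \<Rightarrow> ('r, 'a, 'y) module_scheme \<Rightarrow> ('r, 'b, 'z) module_scheme \<Rightarrow> ('a \<Rightarrow> 'b) set"
  where "linear_maps R M N =
    {f \<in> carrier M \<rightarrow> carrier N.
      (\<forall>x\<in>carrier M. \<forall>y\<in>carrier M. f (x \<oplus>\<^bsub>M\<^esub> y) = f x \<oplus>\<^bsub>N\<^esub> f y) \<and>
      (\<forall>a\<in>carrier R. \<forall>x\<in>carrier M. f (a \<odot>\<^bsub>M\<^esub> x) = a \<odot>\<^bsub>N\<^esub> f x)}"

definition bilinear_maps ::
    "('r, 'x) ring_scheme \<Rightarrow> ('r, 'a, 'y) module_scheme \<Rightarrow> ('r, 'b, 'z) module_scheme \<Rightarrow>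
      ('r, 'c, 'w) module_scheme \<Rightarrow> ('a \<Rightarrow> 'b \<Rightarrow> 'c) set"
  where "bilinear_maps R M N P =
    {b. (\<forall>x\<in>carrier M. b x \<in> linear_maps R N P) \<and>
        (\<forall>y\<in>carrier N. (\<lambda>x. b x y) \<in> linear_maps R M P)}"

text \<open>The record type of modules extends that of rings; the multiplication and the unit have no
  meaning for a module and are left undefined.\<close>

definition free_module :: "('r, 'x) ring_scheme \<Rightarrow> 's set \<Rightarrow> ('r, 's \<Rightarrow> 'r) module"
  where "free_module R S =
    \<lparr>carrier = {u. range u \<subseteq> carrier R \<and> finite {p. u p \<noteq> \<zero>\<^bsub>R\<^esub>} \<and> {p. u p \<noteq> \<zero>\<^bsub>R\<^esub>} \<subseteq> S},
     mult = undefined, one = undefined,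
     zero = (\<lambda>p. \<zero>\<^bsub>R\<^esub>), add = (\<lambda>u v p. u p \<oplus>\<^bsub>R\<^esub> v p),
     smult = (\<lambda>a u p. a \<otimes>\<^bsub>R\<^esub> u p)\<rparr>"

definition free_gen :: "('r, 'x) ring_scheme \<Rightarrow> 's \<Rightarrow> 's \<Rightarrow> 'r"
  where "free_gen R p = (\<lambda>q. if q = p then \<one>\<^bsub>R\<^esub> else \<zero>\<^bsub>R\<^esub>)"

definition generated_submodule ::
    "('r, 'x) ring_scheme \<Rightarrow> ('r, 'a, 'y) module_scheme \<Rightarrow> 'a set \<Rightarrow> 'a set"
  where "generated_submodule R M A = \<Inter> {H. submodule H R M \<and> A \<subseteq> H}"

definition quotient_module :: "('r, 'a, 'y) module_scheme \<Rightarrow> 'a set \<Rightarrow> ('r, 'a set) module"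
  where "quotient_module M H =
    \<lparr>carrier = a_rcosets\<^bsub>M\<^esub> H,
     mult = undefined, one = undefined,
     zero = H, add = set_add M,
     smult = (\<lambda>a X. \<Union>x\<in>X. H +>\<^bsub>M\<^esub> (a \<odot>\<^bsub>M\<^esub> x))\<rparr>"

section \<open>Tensor products\<close>

definition tensor_relations ::
    "('r, 'x) ring_scheme \<Rightarrow> ('r, 'a, 'y) module_scheme \<Rightarrow> ('r, 'b, 'z) module_scheme \<Rightarrow>
      ('a \<times> 'b \<Rightarrow> 'r) set"
  where "tensor_relations R M N =
    (let L = free_module R (carrier M \<times> carrier N); e = (\<lambda>x y. free_gen R (x, y)) in
      {e (x \<oplus>\<^bsub>M\<^esub> x') y \<ominus>\<^bsub>L\<^esub> (e x y \<oplus>\<^bsub>L\<^esub> e x' y) | x x' y.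
        x \<in> carrier M \<and> x' \<in> carrier M \<and> y \<in> carrier N} \<union>
      {e x (y \<oplus>\<^bsub>N\<^esub> y') \<ominus>\<^bsub>L\<^esub> (e x y \<oplus>\<^bsub>L\<^esub> e x y') | x y y'.
        x \<in> carrier M \<and> y \<in> carrier N \<and> y' \<in> carrier N} \<union>
      {e (a \<odot>\<^bsub>M\<^esub> x) y \<ominus>\<^bsub>L\<^esub> a \<odot>\<^bsub>L\<^esub> e x y | a x y.
        a \<in> carrier R \<and> x \<in> carrier M \<and> y \<in> carrier N} \<union>
      {e x (a \<odot>\<^bsub>N\<^esub> y) \<ominus>\<^bsub>L\<^esub> a \<odot>\<^bsub>L\<^esub> e x y | a x y.
        a \<in> carrier R \<and> x \<in> carrier M \<and> y \<in> carrier N})"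

definition tensor_kernel ::
    "('r, 'x) ring_scheme \<Rightarrow> ('r, 'a, 'y) module_scheme \<Rightarrow> ('r, 'b, 'z) module_scheme \<Rightarrow>
      ('a \<times> 'b \<Rightarrow> 'r) set"
  where "tensor_kernel R M N =
    generated_submodule R (free_module R (carrier M \<times> carrier N)) (tensor_relations R M N)"

definition tensor ::
    "('r, 'x) ring_scheme \<Rightarrow> ('r, 'a, 'y) module_scheme \<Rightarrow> ('r, 'b, 'z) module_scheme \<Rightarrow>
      ('r, ('a \<times> 'b \<Rightarrow> 'r) set) module"
  where "tensor R M N =
    quotient_module (free_module R (carrier M \<times> carrier N)) (tensor_kernel R M N)"

definition pure_tensor ::
    "('r, 'x) ring_scheme \<Rightarrow> ('r, 'a, 'y) module_scheme \<Rightarrow> ('r, 'b, 'z) module_scheme \<Rightarrow>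
      'a \<Rightarrow> 'b \<Rightarrow> ('a \<times> 'b \<Rightarrow> 'r) set"
  where "pure_tensor R M N x y =
    tensor_kernel R M N +>\<^bsub>free_module R (carrier M \<times> carrier N)\<^esub> free_gen R (x, y)"

text \<open>The linear map on the tensor product induced by a bilinear map \<open>b\<close>; existence and uniqueness
  are shown in \<open>tensor_universal\<close> below.\<close>

definition tensor_lift ::
    "('r, 'x) ring_scheme \<Rightarrow> ('r, 'a, 'y) module_scheme \<Rightarrow> ('r, 'b, 'z) module_scheme \<Rightarrow>
      ('r, 'c, 'w) module_scheme \<Rightarrow> ('a \<Rightarrow> 'b \<Rightarrow> 'c) \<Rightarrow> ('a \<times> 'b \<Rightarrow> 'r) set \<Rightarrow> 'c"
  where "tensor_lift R M N P b =
    (THE h. h \<in> linear_maps R (tensor R M N) P \<inter> extensional (carrier (tensor R M N)) \<and>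
      (\<forall>x\<in>carrier M. \<forall>y\<in>carrier N. h (pure_tensor R M N x y) = b x y))"

text \<open>\<open>f \<otimes> g : M \<otimes> N \<rightarrow> M' \<otimes> N'\<close>\<close>

definition tensor_map ::
    "('r, 'x) ring_scheme \<Rightarrow> ('r, 'a, 'y) module_scheme \<Rightarrow> ('r, 'b, 'z) module_scheme \<Rightarrow>
      ('r, 'c, 'v) module_scheme \<Rightarrow> ('r, 'd, 'w) module_scheme \<Rightarrow> ('a \<Rightarrow> 'c) \<Rightarrow> ('b \<Rightarrow> 'd) \<Rightarrow>
      ('a \<times> 'b \<Rightarrow> 'r) set \<Rightarrow> ('c \<times> 'd \<Rightarrow> 'r) set"
  where "tensor_map R M N M' N' f g =
    tensor_lift R M N (tensor R M' N') (\<lambda>x y. pure_tensor R M' N' (f x) (g y))"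

text \<open>\<open>\<tau> : M \<otimes> N \<rightarrow> N \<otimes> M\<close>\<close>

definition tensor_swap ::
    "('r, 'x) ring_scheme \<Rightarrow> ('r, 'a, 'y) module_scheme \<Rightarrow> ('r, 'b, 'z) module_scheme \<Rightarrow>
      ('a \<times> 'b \<Rightarrow> 'r) set \<Rightarrow> ('b \<times> 'a \<Rightarrow> 'r) set"
  where "tensor_swap R M N =
    tensor_lift R M N (tensor R N M) (\<lambda>x y. pure_tensor R N M y x)"

text \<open>The canonical map \<open>M \<otimes> (N \<otimes> P) \<rightarrow> (M \<otimes> N) \<otimes> P\<close>, \<open>x \<otimes> (y \<otimes> z) \<mapsto> (x \<otimes> y) \<otimes> z\<close>,
  along which the two threefold tensor products are usually identified tacitly.\<close>

definition tensor_assoc ::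
    "('r, 'x) ring_scheme \<Rightarrow> ('r, 'a, 'y) module_scheme \<Rightarrow> ('r, 'b, 'z) module_scheme \<Rightarrow>
      ('r, 'c, 'w) module_scheme \<Rightarrow>
      ('a \<times> ('b \<times> 'c \<Rightarrow> 'r) set \<Rightarrow> 'r) set \<Rightarrow> (('a \<times> 'b \<Rightarrow> 'r) set \<times> 'c \<Rightarrow> 'r) set"
  where "tensor_assoc R M N P =
    tensor_lift R M (tensor R N P) (tensor R (tensor R M N) P)
      (\<lambda>x. tensor_lift R N P (tensor R (tensor R M N) P)
        (\<lambda>y z. pure_tensor R (tensor R M N) P (pure_tensor R M N x y) z))"

section \<open>The universal property of the tensor product\<close>

context cring
begin

lemma free_module_module:
  fixes S :: "'s set"
  shows "module R (free_module R S)"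
proof (rule moduleI)
  let ?L = "free_module R S"
  have sub: "finite {p. w p \<noteq> \<zero>} \<and> {p. w p \<noteq> \<zero>} \<subseteq> S"
    if "u \<in> carrier ?L" "v \<in> carrier ?L" "\<And>p. u p = \<zero> \<Longrightarrow> v p = \<zero> \<Longrightarrow> w p = \<zero>" for u v w
  proof -
    have "{p. w p \<noteq> \<zero>} \<subseteq> {p. u p \<noteq> \<zero>} \<union> {p. v p \<noteq> \<zero>}" using that(3) by auto
    moreover have "finite ({p. u p \<noteq> \<zero>} \<union> {p. v p \<noteq> \<zero>})" "{p. u p \<noteq> \<zero>} \<union> {p. v p \<noteq> \<zero>} \<subseteq> S"
      using that(1,2) by (auto simp: free_module_def)
    ultimately show ?thesis by (meson finite_subset subset_trans)
  qed
  have range: "range u \<subseteq> carrier R" if "u \<in> carrier ?L" for u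
    using that by (auto simp: free_module_def)
  have cl: "u p \<in> carrier R" if "u \<in> carrier ?L" for u p
    using range[OF that] by auto
  have add_cl: "u \<oplus>\<^bsub>?L\<^esub> v \<in> carrier ?L" if "u \<in> carrier ?L" "v \<in> carrier ?L" for u v
    using sub[OF that, of "\<lambda>p. u p \<oplus> v p"] cl[OF that(1)] cl[OF that(2)]
    by (auto simp: free_module_def)
  have neg_cl: "(\<lambda>p. \<ominus> u p) \<in> carrier ?L" if "u \<in> carrier ?L" for u
    using sub[OF that that, of "\<lambda>p. \<ominus> u p"] cl[OF that]
    by (auto simp: free_module_def)
  show "cring R" by (rule is_cring)
  show "abelian_group ?L"
  proof (rule abelian_groupI)
    show "\<exists>v\<in>carrier ?L. v \<oplus>\<^bsub>?L\<^esub> u = \<zero>\<^bsub>?L\<^esub>" if "u \<in> carrier ?L" for u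
      using neg_cl[OF that] cl[OF that] by (intro bexI[of _ "\<lambda>p. \<ominus> u p"]) (auto simp: free_module_def l_neg)
  qed (use add_cl cl in \<open>auto simp: free_module_def a_ac\<close>)
  show "a \<odot>\<^bsub>?L\<^esub> u \<in> carrier ?L" if "a \<in> carrier R" "u \<in> carrier ?L" for a u
    using sub[OF that(2) that(2), of "\<lambda>p. a \<otimes> u p"] cl[OF that(2)] that(1)
    by (auto simp: free_module_def)
qed (auto simp: free_module_def l_distr r_distr m_assoc fun_eq_iff image_subset_iff)

lemma free_gen_closed: "p \<in> S \<Longrightarrow> free_gen R p \<in> carrier (free_module R S)"
  by (auto simp: free_module_def free_gen_def intro: finite_subset[of _ "{p}"])

text \<open>The generators span the free module.\<close>

lemma free_module_induct:
  assumes H: "submodule H R (free_module R S)" and gen: "\<And>p. p \<in> S \<Longrightarrow> free_gen R p \<in> H"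
    and u: "u \<in> carrier (free_module R S)"
  shows "u \<in> H"
proof -
  interpret L: module R "free_module R S" by (rule free_module_module)
  have "finite A \<Longrightarrow> \<forall>u\<in>carrier (free_module R S). {p. u p \<noteq> \<zero>} \<subseteq> A \<longrightarrow> u \<in> H" for A
  proof (induction A rule: finite_induct)
    case empty
    have "u = \<zero>\<^bsub>free_module R S\<^esub>" if "{p. u p \<noteq> \<zero>} \<subseteq> {}" for u
      using that by (auto simp: free_module_def)
    then show ?case
      using subgroup.one_closed[OF submodule.axioms(1)[OF H]] by auto
  next
    case (insert q A)
    show ?case
    proof (intro ballI impI)
      fix u assume u: "u \<in> carrier (free_module R S)" and supp: "{p. u p \<noteq> \<zero>} \<subseteq> insert q A"
      have cl: "u p \<in> carrier R" for p using u by (auto simp: free_module_def)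
      show "u \<in> H"
      proof (cases "u q = \<zero>")
        case True
        then show ?thesis using insert.IH u supp by blast
      next
        case False
        then have q: "q \<in> S" using u by (auto simp: free_module_def)
        let ?v = "u(q := \<zero>)"
        have "{p. ?v p \<noteq> \<zero>} \<subseteq> {p. u p \<noteq> \<zero>}" by auto
        then have v: "?v \<in> carrier (free_module R S)"
          using u by (auto simp: free_module_def intro: finite_subset)
        have "{p. ?v p \<noteq> \<zero>} \<subseteq> A" using supp by auto
        then have "?v \<in> H" using insert.IH v by blast
        moreover have "u q \<odot>\<^bsub>free_module R S\<^esub> free_gen R q \<in> H"
          using submodule.smult_closed[OF H cl gen[OF q]] .
        ultimately have "?v \<oplus>\<^bsub>free_module R S\<^esub> (u q \<odot>\<^bsub>free_module R S\<^esub> free_gen R q) \<in> H"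
          using L.submoduleE(5)[OF H] by blast
        moreover have "?v \<oplus>\<^bsub>free_module R S\<^esub> (u q \<odot>\<^bsub>free_module R S\<^esub> free_gen R q) = u"
          using cl by (auto simp: free_module_def free_gen_def fun_eq_iff)
        ultimately show ?thesis by simp
      qed
    qed
  qed
  moreover have "finite {p. u p \<noteq> \<zero>}" using u by (auto simp: free_module_def)
  ultimately show ?thesis using u by blast
qed

end

context module
begin

lemma generated_submodule_submodule:
  assumes "A \<subseteq> carrier M"
  shows "submodule (generated_submodule R M A) R M"
proof -
  have c: "submodule (carrier M) R M \<and> A \<subseteq> carrier M"
    using assms carrier_is_submodule by auto
  show ?thesis
    unfolding generated_submodule_def
  proof (rule submoduleI)
    show "\<Inter> {H. submodule H R M \<and> A \<subseteq> H} \<subseteq> carrier M" using c by blast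
    show "\<zero>\<^bsub>M\<^esub> \<in> \<Inter> {H. submodule H R M \<and> A \<subseteq> H}"
      using subgroup.one_closed[OF submodule.axioms(1)] by fastforce
  qed (use submoduleE(3,4,5) in blast)+
qed

lemma generated_submodule_minimal:
  "submodule H R M \<Longrightarrow> A \<subseteq> H \<Longrightarrow> generated_submodule R M A \<subseteq> H"
  by (auto simp: generated_submodule_def)

lemma generated_submodule_incl: "A \<subseteq> generated_submodule R M A"
  by (auto simp: generated_submodule_def)

lemma quotient_smult:
  assumes H: "submodule H R M" and a: "a \<in> carrier R" and v: "v \<in> carrier M"
  shows "a \<odot>\<^bsub>quotient_module M H\<^esub> (H +>\<^bsub>M\<^esub> v) = H +>\<^bsub>M\<^esub> (a \<odot>\<^bsub>M\<^esub> v)"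
proof -
  interpret H: additive_subgroup H M using H by (simp add: additive_subgroup_def submodule_def)
  interpret H: abelian_subgroup H M
    by (rule abelian_subgroupI3) (use H M.abelian_group_axioms in \<open>simp_all add: additive_subgroup_def submodule_def\<close>)
  have "H +>\<^bsub>M\<^esub> (a \<odot>\<^bsub>M\<^esub> x) = H +>\<^bsub>M\<^esub> (a \<odot>\<^bsub>M\<^esub> v)" if x: "x \<in> H +>\<^bsub>M\<^esub> v" for x
  proof -
    obtain h where h: "h \<in> H" "x = h \<oplus>\<^bsub>M\<^esub> v"
      using x by (auto simp: a_r_coset_def r_coset_def)
    then have "a \<odot>\<^bsub>M\<^esub> x = a \<odot>\<^bsub>M\<^esub> h \<oplus>\<^bsub>M\<^esub> a \<odot>\<^bsub>M\<^esub> v"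
      using a v H.a_subset by (auto intro: smult_r_distr)
    moreover have "a \<odot>\<^bsub>M\<^esub> h \<in> H" using submodule.smult_closed[OF H a h(1)] .
    ultimately have "a \<odot>\<^bsub>M\<^esub> x \<in> H +>\<^bsub>M\<^esub> (a \<odot>\<^bsub>M\<^esub> v)"
      by (auto simp: a_r_coset_def r_coset_def)
    then show ?thesis using a v H.a_subgroup by (metis M.a_repr_independence smult_closed)
  qed
  then have "(\<Union>x\<in>H +>\<^bsub>M\<^esub> v. H +>\<^bsub>M\<^esub> (a \<odot>\<^bsub>M\<^esub> x)) = (\<Union>x\<in>H +>\<^bsub>M\<^esub> v. H +>\<^bsub>M\<^esub> (a \<odot>\<^bsub>M\<^esub> v))"
    by (rule SUP_cong[OF refl])
  moreover have "H +>\<^bsub>M\<^esub> v \<noteq> {}" using H.a_rcos_self[OF v] by blast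
  ultimately show ?thesis by (simp add: quotient_module_def)
qed

lemma quotient_add:
  assumes H: "submodule H R M" and "u \<in> carrier M" "v \<in> carrier M"
  shows "(H +>\<^bsub>M\<^esub> u) \<oplus>\<^bsub>quotient_module M H\<^esub> (H +>\<^bsub>M\<^esub> v) = H +>\<^bsub>M\<^esub> (u \<oplus>\<^bsub>M\<^esub> v)"
proof -
  interpret H: abelian_subgroup H M
    by (rule abelian_subgroupI3) (use H M.abelian_group_axioms in \<open>simp_all add: additive_subgroup_def submodule_def\<close>)
  show ?thesis using assms(2,3) by (simp add: quotient_module_def H.a_rcos_sum)
qed

lemma quotient_carrier:
  "carrier (quotient_module M H) = (\<lambda>u. H +>\<^bsub>M\<^esub> u) ` carrier M"
  by (auto simp: quotient_module_def A_RCOSETS_def' )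

lemma quotient_zero:
  assumes H: "submodule H R M"
  shows "\<zero>\<^bsub>quotient_module M H\<^esub> = H +>\<^bsub>M\<^esub> \<zero>\<^bsub>M\<^esub>"
proof -
  interpret H: abelian_subgroup H M
    by (rule abelian_subgroupI3) (use H M.abelian_group_axioms in \<open>simp_all add: additive_subgroup_def submodule_def\<close>)
  show ?thesis by (simp add: quotient_module_def M.a_coset_add_zero H.a_subset)
qed

lemma quotient_module_module:
  assumes H: "submodule H R M"
  shows "module R (quotient_module M H)"
proof -
  note simps = quotient_carrier quotient_zero[OF H] quotient_add[OF H] quotient_smult[OF H]
  have inv: "\<exists>y\<in>carrier M. H +>\<^bsub>M\<^esub> (y \<oplus>\<^bsub>M\<^esub> x) = H +>\<^bsub>M\<^esub> \<zero>\<^bsub>M\<^esub>" if "x \<in> carrier M" for x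
    using that by (intro bexI[of _ "\<ominus>\<^bsub>M\<^esub> x"]) (auto simp: M.l_neg)
  have "abelian_group (quotient_module M H)"
    by (rule abelian_groupI) (use inv in \<open>auto simp: simps M.a_ac\<close>)
  then show ?thesis
    by (intro moduleI is_cring)
       (auto simp: simps smult_l_distr smult_r_distr smult_assoc1)
qed

end

lemma linear_equalizer:
  assumes "module R M" "module R P" "f \<in> linear_maps R M P" "g \<in> linear_maps R M P"
  shows "submodule {x \<in> carrier M. f x = g x} R M"
proof -
  interpret M: module R M by fact
  interpret P: module R P by fact
  have zero: "h \<zero>\<^bsub>M\<^esub> = \<zero>\<^bsub>P\<^esub>" if "h \<in> linear_maps R M P" for h
  proof -
    have "h (\<zero>\<^bsub>R\<^esub> \<odot>\<^bsub>M\<^esub> \<zero>\<^bsub>M\<^esub>) = \<zero>\<^bsub>R\<^esub> \<odot>\<^bsub>P\<^esub> h \<zero>\<^bsub>M\<^esub>"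
      using that M.R.zero_closed M.M.zero_closed unfolding linear_maps_def by blast
    moreover have "h \<zero>\<^bsub>M\<^esub> \<in> carrier P" using that by (auto simp: linear_maps_def)
    ultimately show ?thesis by simp
  qed
  have neg: "h (\<ominus>\<^bsub>M\<^esub> x) = \<ominus>\<^bsub>P\<^esub> h x" if h: "h \<in> linear_maps R M P" and x: "x \<in> carrier M" for h x
  proof -
    have c: "h x \<in> carrier P" "h (\<ominus>\<^bsub>M\<^esub> x) \<in> carrier P"
      using h x by (auto simp: linear_maps_def)
    have "h (\<ominus>\<^bsub>M\<^esub> x \<oplus>\<^bsub>M\<^esub> x) = h (\<ominus>\<^bsub>M\<^esub> x) \<oplus>\<^bsub>P\<^esub> h x"
      using h x M.M.a_inv_closed unfolding linear_maps_def by blast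
    then have "h (\<ominus>\<^bsub>M\<^esub> x) \<oplus>\<^bsub>P\<^esub> h x = \<zero>\<^bsub>P\<^esub>" using zero[OF h] x by (simp add: M.M.l_neg)
    then show ?thesis using c by (metis P.M.minus_equality)
  qed
  show ?thesis
    using zero[OF assms(3)] zero[OF assms(4)] neg[OF assms(3)] neg[OF assms(4)] assms(3,4)
    by (intro M.submoduleI) (auto simp: linear_maps_def)
qed

text \<open>The linear extension of a map on the basis of a free module.\<close>

lemma free_module_lift:
  assumes P: "module R P" and b: "b \<in> S \<rightarrow> carrier P"
  obtains h where "h \<in> linear_maps R (free_module R S) P" "\<And>p. p \<in> S \<Longrightarrow> h (free_gen R p) = b p"
proof -
  interpret P: module R P by fact
  let ?L = "free_module R S"
  let ?h = "\<lambda>u. \<Oplus>\<^bsub>P\<^esub>p\<in>{p. u p \<noteq> \<zero>\<^bsub>R\<^esub>}. u p \<odot>\<^bsub>P\<^esub> b p"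
  have cl: "u p \<in> carrier R" if "u \<in> carrier ?L" for u p
    using that by (auto simp: free_module_def)
  have term_cl: "(\<lambda>p. u p \<odot>\<^bsub>P\<^esub> b p) \<in> A \<rightarrow> carrier P" if "u \<in> carrier ?L" "A \<subseteq> S" for u A
  proof (rule Pi_I)
    fix p assume "p \<in> A"
    then show "u p \<odot>\<^bsub>P\<^esub> b p \<in> carrier P" using that cl[OF that(1)] b by blast
  qed
  have ext: "?h u = (\<Oplus>\<^bsub>P\<^esub>p\<in>A. u p \<odot>\<^bsub>P\<^esub> b p)"
    if "u \<in> carrier ?L" "finite A" "A \<subseteq> S" "{p. u p \<noteq> \<zero>\<^bsub>R\<^esub>} \<subseteq> A" for u A
  proof (rule P.add.finprod_mono_neutral_cong_left)
    show "u i \<odot>\<^bsub>P\<^esub> b i = \<zero>\<^bsub>P\<^esub>" if "i \<in> A - {p. u p \<noteq> \<zero>\<^bsub>R\<^esub>}" for i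
      using \<open>A \<subseteq> S\<close> that b by (auto simp: Pi_iff)
  qed (use that term_cl[OF that(1,3)] in auto)
  have supp: "finite {p. u p \<noteq> \<zero>\<^bsub>R\<^esub>}" "{p. u p \<noteq> \<zero>\<^bsub>R\<^esub>} \<subseteq> S" if "u \<in> carrier ?L" for u
    using that by (auto simp: free_module_def)
  interpret L: module R ?L by (rule P.free_module_module)
  have lin: "?h \<in> linear_maps R ?L P"
    unfolding linear_maps_def
  proof (intro CollectI conjI ballI)
    show "?h \<in> carrier ?L \<rightarrow> carrier P"
      using supp term_cl by (auto intro!: P.M.finsum_closed)
    fix u assume u: "u \<in> carrier ?L"
    show "?h (u \<oplus>\<^bsub>?L\<^esub> v) = ?h u \<oplus>\<^bsub>P\<^esub> ?h v" if v: "v \<in> carrier ?L" for v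
    proof -
      let ?A = "{p. u p \<noteq> \<zero>\<^bsub>R\<^esub>} \<union> {p. v p \<noteq> \<zero>\<^bsub>R\<^esub>}"
      have A: "finite ?A" "?A \<subseteq> S" using supp[OF u] supp[OF v] by auto
      have sA: "{p. (u \<oplus>\<^bsub>?L\<^esub> v) p \<noteq> \<zero>\<^bsub>R\<^esub>} \<subseteq> ?A" by (auto simp: free_module_def)
      have "?h (u \<oplus>\<^bsub>?L\<^esub> v) = (\<Oplus>\<^bsub>P\<^esub>p\<in>?A. (u \<oplus>\<^bsub>?L\<^esub> v) p \<odot>\<^bsub>P\<^esub> b p)"
        by (rule ext[OF _ A sA]) (use u v in simp)
      also have "\<dots> = (\<Oplus>\<^bsub>P\<^esub>p\<in>?A. u p \<odot>\<^bsub>P\<^esub> b p \<oplus>\<^bsub>P\<^esub> v p \<odot>\<^bsub>P\<^esub> b p)"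
      proof (rule P.M.finsum_cong')
        show "(u \<oplus>\<^bsub>?L\<^esub> v) p \<odot>\<^bsub>P\<^esub> b p = u p \<odot>\<^bsub>P\<^esub> b p \<oplus>\<^bsub>P\<^esub> v p \<odot>\<^bsub>P\<^esub> b p" if "p \<in> ?A" for p
        proof -
          have "b p \<in> carrier P" using b that A(2) by blast
          then show ?thesis
            using P.smult_l_distr[OF cl[OF u] cl[OF v]] by (simp add: free_module_def)
        qed
      qed (use term_cl[OF u A(2)] term_cl[OF v A(2)] in auto)
      also have "\<dots> = ?h u \<oplus>\<^bsub>P\<^esub> ?h v"
        using ext[OF u A] ext[OF v A] P.M.finsum_addf[OF term_cl[OF u A(2)] term_cl[OF v A(2)]] by auto
      finally show ?thesis .
    qed
  next
    fix a u assume a: "a \<in> carrier R" and u: "u \<in> carrier ?L"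
    let ?A = "{p. u p \<noteq> \<zero>\<^bsub>R\<^esub>}"
    have sA: "{p. (a \<odot>\<^bsub>?L\<^esub> u) p \<noteq> \<zero>\<^bsub>R\<^esub>} \<subseteq> ?A" using a by (auto simp: free_module_def)
    have "?h (a \<odot>\<^bsub>?L\<^esub> u) = (\<Oplus>\<^bsub>P\<^esub>p\<in>?A. (a \<odot>\<^bsub>?L\<^esub> u) p \<odot>\<^bsub>P\<^esub> b p)"
      by (rule ext[OF _ supp[OF u] sA]) (use a u in simp)
    also have "\<dots> = (\<Oplus>\<^bsub>P\<^esub>p\<in>?A. a \<odot>\<^bsub>P\<^esub> (u p \<odot>\<^bsub>P\<^esub> b p))"
    proof (rule P.M.finsum_cong')
      show "(a \<odot>\<^bsub>?L\<^esub> u) p \<odot>\<^bsub>P\<^esub> b p = a \<odot>\<^bsub>P\<^esub> (u p \<odot>\<^bsub>P\<^esub> b p)" if "p \<in> ?A" for p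
      proof -
        have "b p \<in> carrier P" using b that supp(2)[OF u] by blast
        then show ?thesis
          using P.smult_assoc1[OF a cl[OF u]] by (simp add: free_module_def)
      qed
    qed (use a term_cl[OF u supp(2)[OF u]] in auto)
    also have "\<dots> = a \<odot>\<^bsub>P\<^esub> ?h u"
      by (rule P.finsum_smult_ldistr[symmetric, OF supp(1)[OF u] a term_cl[OF u supp(2)[OF u]]])
    finally show "?h (a \<odot>\<^bsub>?L\<^esub> u) = a \<odot>\<^bsub>P\<^esub> ?h u" .
  qed
  have gen: "?h (free_gen R p) = b p" if p: "p \<in> S" for p
  proof -
    have "?h (free_gen R p) = (\<Oplus>\<^bsub>P\<^esub>q\<in>{p}. free_gen R p q \<odot>\<^bsub>P\<^esub> b q)"
      by (rule ext[OF P.free_gen_closed[OF p]]) (use p in \<open>auto simp: free_gen_def\<close>)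
    also have "\<dots> = b p" using p b by (simp add: free_gen_def Pi_iff)
    finally show ?thesis .
  qed
  show thesis using lin gen by (rule that)
qed

locale two_modules = M: module R M + N: module R N for R M N
begin

abbreviation "L \<equiv> free_module R (carrier M \<times> carrier N)"
abbreviation "K \<equiv> tensor_kernel R M N"

sublocale L: module R L by (rule M.free_module_module)

lemma gen_closed: "x \<in> carrier M \<Longrightarrow> y \<in> carrier N \<Longrightarrow> free_gen R (x, y) \<in> carrier L"
  by (simp add: M.free_gen_closed)

lemma relations_closed: "tensor_relations R M N \<subseteq> carrier L"
  unfolding tensor_relations_def Let_def
  by (auto intro!: L.M.minus_closed L.M.a_closed L.smult_closed gen_closed)

lemma kernel_submodule: "submodule K R L"
  unfolding tensor_kernel_def by (rule L.generated_submodule_submodule[OF relations_closed])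

lemma tensor_module: "module R (tensor R M N)"
  unfolding tensor_def by (rule L.quotient_module_module[OF kernel_submodule])

abbreviation "proj u \<equiv> K +>\<^bsub>L\<^esub> u"

lemma proj_linear: "(\<lambda>u. proj u) \<in> linear_maps R L (tensor R M N)"
  by (auto simp: linear_maps_def tensor_def L.quotient_carrier L.quotient_add[OF kernel_submodule]
      L.quotient_smult[OF kernel_submodule])

lemma tensor_carrier: "carrier (tensor R M N) = (\<lambda>u. proj u) ` carrier L"
  by (simp add: tensor_def L.quotient_carrier)

lemma proj_eq:
  assumes "u \<in> carrier L" "v \<in> carrier L"
  shows "proj u = proj v \<longleftrightarrow> u \<ominus>\<^bsub>L\<^esub> v \<in> K"
proof -
  interpret K: abelian_subgroup K L
    by (rule abelian_subgroupI3)
      (use kernel_submodule L.M.abelian_group_axioms in \<open>simp_all add: additive_subgroup_def submodule_def\<close>)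
  have "proj u = proj v \<longleftrightarrow> u \<in> proj v"
    using K.a_subgroup by (metis K.a_rcos_self L.M.a_repr_independence assms)
  also have "\<dots> \<longleftrightarrow> u \<ominus>\<^bsub>L\<^esub> v \<in> K"
    using K.a_rcos_module[OF assms(2,1)] by (simp add: a_minus_def)
  finally show ?thesis .
qed

lemma pure_bilinear: "pure_tensor R M N \<in> bilinear_maps R M N (tensor R M N)"
proof -
  have step: "proj u = proj v" if "u \<in> carrier L" "v \<in> carrier L" "u \<ominus>\<^bsub>L\<^esub> v \<in> tensor_relations R M N" for u v
    using proj_eq[OF that(1,2)] that(3) L.generated_submodule_incl by (auto simp: tensor_kernel_def)
  note rel = tensor_relations_def[unfolded Let_def, THEN equalityD2, THEN subsetD]
  note p = proj_linear[unfolded linear_maps_def]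
  have add: "proj (u \<oplus>\<^bsub>L\<^esub> v) = proj u \<oplus>\<^bsub>tensor R M N\<^esub> proj v" if "u \<in> carrier L" "v \<in> carrier L" for u v
    using p that by blast
  have smult: "proj (a \<odot>\<^bsub>L\<^esub> v) = a \<odot>\<^bsub>tensor R M N\<^esub> proj v" if "a \<in> carrier R" "v \<in> carrier L" for a v
    using p that by blast
  have cl: "proj u \<in> carrier (tensor R M N)" if "u \<in> carrier L" for u
    using p that by blast
  have 1: "proj (free_gen R (x \<oplus>\<^bsub>M\<^esub> x', y)) = proj (free_gen R (x, y) \<oplus>\<^bsub>L\<^esub> free_gen R (x', y))"
    if "x \<in> carrier M" "x' \<in> carrier M" "y \<in> carrier N" for x x' y
    by (rule step[OF _ _ rel]; (use that gen_closed in \<open>simp; fail\<close>)?; use that in blast)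
  have 2: "proj (free_gen R (x, y \<oplus>\<^bsub>N\<^esub> y')) = proj (free_gen R (x, y) \<oplus>\<^bsub>L\<^esub> free_gen R (x, y'))"
    if "x \<in> carrier M" "y \<in> carrier N" "y' \<in> carrier N" for x y y'
    by (rule step[OF _ _ rel]; (use that gen_closed in \<open>simp; fail\<close>)?; use that in blast)
  have 3: "proj (free_gen R (a \<odot>\<^bsub>M\<^esub> x, y)) = proj (a \<odot>\<^bsub>L\<^esub> free_gen R (x, y))"
    if "a \<in> carrier R" "x \<in> carrier M" "y \<in> carrier N" for a x y
    by (rule step[OF _ _ rel]; (use that gen_closed in \<open>simp; fail\<close>)?; use that in blast)
  have 4: "proj (free_gen R (x, a \<odot>\<^bsub>N\<^esub> y)) = proj (a \<odot>\<^bsub>L\<^esub> free_gen R (x, y))"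
    if "a \<in> carrier R" "x \<in> carrier M" "y \<in> carrier N" for a x y
    by (rule step[OF _ _ rel]; (use that gen_closed in \<open>simp; fail\<close>)?; use that in blast)
  show ?thesis
    by (auto simp: bilinear_maps_def linear_maps_def pure_tensor_def 1 2 3 4 add smult gen_closed cl)
qed

lemma tensor_ext:
  assumes P: "module R P" and f: "f \<in> linear_maps R (tensor R M N) P" and g: "g \<in> linear_maps R (tensor R M N) P"
    and eq: "\<And>x y. x \<in> carrier M \<Longrightarrow> y \<in> carrier N \<Longrightarrow> f (pure_tensor R M N x y) = g (pure_tensor R M N x y)"
    and t: "t \<in> carrier (tensor R M N)"
  shows "f t = g t"
proof -
  have comp: "(\<lambda>u. h (proj u)) \<in> linear_maps R L P" if "h \<in> linear_maps R (tensor R M N) P" for h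
  proof -
    have cl: "proj v \<in> carrier (tensor R M N)" if "v \<in> carrier L" for v
      using that tensor_carrier by auto
    note p = proj_linear cl
    have "h (proj (u \<oplus>\<^bsub>L\<^esub> v)) = h (proj u) \<oplus>\<^bsub>P\<^esub> h (proj v)" if "u \<in> carrier L" "v \<in> carrier L" for u v
      using p \<open>h \<in> _\<close> that by (auto simp: linear_maps_def)
    moreover have "h (proj (a \<odot>\<^bsub>L\<^esub> v)) = a \<odot>\<^bsub>P\<^esub> h (proj v)" if "a \<in> carrier R" "v \<in> carrier L" for a v
      using p \<open>h \<in> _\<close> that by (auto simp: linear_maps_def)
    moreover have "h (proj v) \<in> carrier P" if "v \<in> carrier L" for v
      using p \<open>h \<in> _\<close> that by (auto simp: linear_maps_def)
    ultimately show ?thesis unfolding linear_maps_def by auto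
  qed
  obtain u where u: "u \<in> carrier L" "t = proj u" using t tensor_carrier by auto
  have "u \<in> {u \<in> carrier L. f (proj u) = g (proj u)}"
    by (rule M.free_module_induct[OF linear_equalizer[OF L.module_axioms P comp[OF f] comp[OF g]] _ u(1)])
      (use eq gen_closed in \<open>auto simp: pure_tensor_def\<close>)
  then show ?thesis using u by simp
qed

theorem tensor_universal:
  assumes P: "module R P" and b: "b \<in> bilinear_maps R M N P"
  shows "\<exists>!h. h \<in> linear_maps R (tensor R M N) P \<inter> extensional (carrier (tensor R M N)) \<and>
    (\<forall>x\<in>carrier M. \<forall>y\<in>carrier N. h (pure_tensor R M N x y) = b x y)"
proof (rule ex_ex1I)
  interpret P: module R P by fact
  have bcl: "(\<lambda>(x, y). b x y) \<in> carrier M \<times> carrier N \<rightarrow> carrier P"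
    using b by (auto simp: bilinear_maps_def linear_maps_def)
  obtain e where e: "e \<in> linear_maps R L P"
    and e_gen: "\<And>p. p \<in> carrier M \<times> carrier N \<Longrightarrow> e (free_gen R p) = (\<lambda>(x, y). b x y) p"
    using free_module_lift[OF P bcl] by blast
  have e_add: "e (u \<oplus>\<^bsub>L\<^esub> v) = e u \<oplus>\<^bsub>P\<^esub> e v" if "u \<in> carrier L" "v \<in> carrier L" for u v
    using e that by (auto simp: linear_maps_def)
  have e_smult: "e (a \<odot>\<^bsub>L\<^esub> v) = a \<odot>\<^bsub>P\<^esub> e v" if "a \<in> carrier R" "v \<in> carrier L" for a v
    using e that by (auto simp: linear_maps_def)
  have e_cl: "e v \<in> carrier P" if "v \<in> carrier L" for v
    using e that by (auto simp: linear_maps_def)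
  have e_eq: "e (u \<ominus>\<^bsub>L\<^esub> v) = \<zero>\<^bsub>P\<^esub> \<longleftrightarrow> e u = e v" if "u \<in> carrier L" "v \<in> carrier L" for u v
  proof -
    have c: "u \<ominus>\<^bsub>L\<^esub> v \<in> carrier L" using that by (rule L.M.minus_closed)
    have "e u = e ((u \<ominus>\<^bsub>L\<^esub> v) \<oplus>\<^bsub>L\<^esub> v)"
      using that by (simp add: a_minus_def L.M.a_assoc L.M.l_neg)
    also have "\<dots> = e (u \<ominus>\<^bsub>L\<^esub> v) \<oplus>\<^bsub>P\<^esub> e v" using c that(2) by (rule e_add)
    finally show ?thesis using e_cl[OF c] e_cl[OF that(1)] e_cl[OF that(2)]
      by (metis P.M.add.l_cancel_one P.M.a_comm)
  qed
  have zero_lin: "(\<lambda>_. \<zero>\<^bsub>P\<^esub>) \<in> linear_maps R L P" by (auto simp: linear_maps_def)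
  have "K \<subseteq> {u \<in> carrier L. e u = \<zero>\<^bsub>P\<^esub>}"
    unfolding tensor_kernel_def
  proof (rule L.generated_submodule_minimal[OF linear_equalizer[OF L.module_axioms P e zero_lin]])
    have b': "b (a \<odot>\<^bsub>M\<^esub> x) y = a \<odot>\<^bsub>P\<^esub> b x y"
      if "x \<in> carrier M" "y \<in> carrier N" "a \<in> carrier R" for x y a
      using b that by (auto simp: bilinear_maps_def linear_maps_def)
    have b'': "b x (a \<odot>\<^bsub>N\<^esub> y) = a \<odot>\<^bsub>P\<^esub> b x y"
      if "x \<in> carrier M" "y \<in> carrier N" "a \<in> carrier R" for x y a
      using b that by (auto simp: bilinear_maps_def linear_maps_def)
    have b_add: "b (x \<oplus>\<^bsub>M\<^esub> x') y = b x y \<oplus>\<^bsub>P\<^esub> b x' y"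
      if "x \<in> carrier M" "x' \<in> carrier M" "y \<in> carrier N" for x x' y
      using b that by (auto simp: bilinear_maps_def linear_maps_def)
    have b_add': "b x (y \<oplus>\<^bsub>N\<^esub> y') = b x y \<oplus>\<^bsub>P\<^esub> b x y'"
      if "x \<in> carrier M" "y \<in> carrier N" "y' \<in> carrier N" for x y y'
      using b that by (auto simp: bilinear_maps_def linear_maps_def)
    have "e r = \<zero>\<^bsub>P\<^esub>" if "r \<in> tensor_relations R M N" for r
      using that unfolding tensor_relations_def Let_def
      by (auto simp: e_eq gen_closed e_add e_smult e_gen b_add b_add' b' b'')
    then show "tensor_relations R M N \<subseteq> {u \<in> carrier L. e u = \<zero>\<^bsub>P\<^esub>}"
      using relations_closed by auto
  qed
  then have inv: "e u = e v" if "proj u = proj v" "u \<in> carrier L" "v \<in> carrier L" for u v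
    using that proj_eq e_eq by blast
  define h where "h = (\<lambda>t\<in>carrier (tensor R M N). e (SOME u. u \<in> carrier L \<and> proj u = t))"
  have h: "h (proj u) = e u" if "u \<in> carrier L" for u
  proof -
    let ?v = "SOME v. v \<in> carrier L \<and> proj v = proj u"
    have v: "?v \<in> carrier L \<and> proj ?v = proj u"
      by (rule someI[of _ u]) (use that in simp)
    have "proj u \<in> carrier (tensor R M N)" using that tensor_carrier by auto
    then have "h (proj u) = e ?v" unfolding h_def by (rule restrict_apply')
    also have "\<dots> = e u" using v that by (intro inv) auto
    finally show ?thesis .
  qed
  have p_add: "proj u \<oplus>\<^bsub>tensor R M N\<^esub> proj v = proj (u \<oplus>\<^bsub>L\<^esub> v)" if "u \<in> carrier L" "v \<in> carrier L" for u v
    using proj_linear that by (auto simp: linear_maps_def)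
  have p_smult: "a \<odot>\<^bsub>tensor R M N\<^esub> proj v = proj (a \<odot>\<^bsub>L\<^esub> v)" if "a \<in> carrier R" "v \<in> carrier L" for a v
    using proj_linear that by (auto simp: linear_maps_def)
  have "h \<in> linear_maps R (tensor R M N) P"
    unfolding linear_maps_def tensor_carrier
    by (auto simp: h e_cl p_add p_smult e_add e_smult)
  moreover have "h \<in> extensional (carrier (tensor R M N))" by (simp add: h_def)
  moreover have "h (pure_tensor R M N x y) = b x y" if "x \<in> carrier M" "y \<in> carrier N" for x y
    using that by (simp add: pure_tensor_def h gen_closed e_gen)
  ultimately show "\<exists>h. h \<in> linear_maps R (tensor R M N) P \<inter> extensional (carrier (tensor R M N)) \<and>
    (\<forall>x\<in>carrier M. \<forall>y\<in>carrier N. h (pure_tensor R M N x y) = b x y)" by blast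
next
  show "h = h'" if "h \<in> linear_maps R (tensor R M N) P \<inter> extensional (carrier (tensor R M N)) \<and>
      (\<forall>x\<in>carrier M. \<forall>y\<in>carrier N. h (pure_tensor R M N x y) = b x y)"
    "h' \<in> linear_maps R (tensor R M N) P \<inter> extensional (carrier (tensor R M N)) \<and>
      (\<forall>x\<in>carrier M. \<forall>y\<in>carrier N. h' (pure_tensor R M N x y) = b x y)" for h h'
    by (rule extensionalityI[of _ "carrier (tensor R M N)"]) (use that tensor_ext[OF P, of h h'] in auto)
qed

end


section \<open>Hom-coalgebras\<close>

locale vector_space_char_0 = module F C + field F for F C +
  assumes char_0: "0 < (n::nat) \<Longrightarrow> [n] \<cdot>\<^bsub>F\<^esub> \<one>\<^bsub>F\<^esub> \<noteq> \<zero>\<^bsub>F\<^esub>"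
begin

abbreviation CC where "CC \<equiv> tensor F C C"

abbreviation CCC where "CCC \<equiv> tensor F CC C"

text \<open>For linear maps \<open>D : C \<rightarrow> C \<otimes> C\<close> and \<open>f : C \<rightarrow> C\<close>, the maps \<open>D \<otimes> f\<close> and \<open>f \<otimes> D\<close> from
  \<open>C \<otimes> C\<close>, both with values in \<open>(C \<otimes> C) \<otimes> C\<close>.\<close>

abbreviation tensor_left where "tensor_left D f \<equiv> tensor_map F C C CC C D f"

abbreviation tensor_right where
  "tensor_right f D \<equiv> tensor_assoc F C C C \<circ> tensor_map F C C C CC f D"

end

locale hom_dendriform_coalgebra = vector_space_char_0 F C for F C +
  fixes Dm Dp \<alpha>  \<comment> \<open>\<open>\<Delta>\<^sub>-\<^sub>1\<close>, \<open>\<Delta>\<^sub>1\<close> and \<open>\<alpha>\<close>\<close>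
  assumes Dm_linear: "Dm \<in> linear_maps F C CC"
    and Dp_linear: "Dp \<in> linear_maps F C CC"
    and alpha_linear: "\<alpha> \<in> linear_maps F C C"
    and left_axiom: "c \<in> carrier C \<Longrightarrow>
      tensor_left Dm \<alpha> (Dm c) = tensor_right \<alpha> Dm (Dm c) \<oplus>\<^bsub>CCC\<^esub> tensor_right \<alpha> Dp (Dm c)"
    and middle_axiom: "c \<in> carrier C \<Longrightarrow>
      tensor_left Dp \<alpha> (Dm c) = tensor_right \<alpha> Dm (Dp c)"
    and right_axiom: "c \<in> carrier C \<Longrightarrow>
      tensor_right \<alpha> Dp (Dp c) = tensor_left Dm \<alpha> (Dp c) \<oplus>\<^bsub>CCC\<^esub> tensor_left Dp \<alpha> (Dp c)"

locale hom_prelie_coalgebra = vector_space_char_0 F C for F C +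
  fixes D \<alpha>
  assumes D_linear: "D \<in> linear_maps F C CC"
    and alpha_linear: "\<alpha> \<in> linear_maps F C C"
    and prelie_axiom: "c \<in> carrier C \<Longrightarrow>
      tensor_left D \<alpha> (D c) \<ominus>\<^bsub>CCC\<^esub> tensor_right \<alpha> D (D c) =
      tensor_map F CC C CC C (tensor_swap F C C) id
        (tensor_left D \<alpha> (D c) \<ominus>\<^bsub>CCC\<^esub> tensor_right \<alpha> D (D c))"

end

(* On C (x) C (x) C let \<sigma> exchange the first two factors and let
   \<kappa> (x (x) y (x) z) = z (x) x (x) y; then \<sigma>\<^sup>2 = \<kappa>\<^sup>3 = 1 and
   \<kappa> \<sigma> \<kappa> = \<sigma>.  For every linear D : C -> C (x) C,
   \<alpha> (x) D = \<kappa> (D (x) \<alpha>) \<tau> and (\<tau> D) (x) \<alpha> = \<sigma> (D (x) \<alpha>), so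
   everything is expressed by the maps m = \<Delta>\<^sub>-\<^sub>1 (x) \<alpha> and
   p = \<Delta>\<^sub>1 (x) \<alpha>.  The three dendriform axioms then turn the coassociator of
   \<Delta> into y + \<sigma> y with
   y = \<kappa> p \<Delta>\<^sub>-\<^sub>1 - m \<Delta>\<^sub>1 - p \<tau> \<Delta>\<^sub>-\<^sub>1,
   which is fixed by \<sigma>. *)

theory Submission
  imports Defs
begin

section \<open>Calculus of linear maps\<close>

lemma linear_maps_closed: "f \<in> linear_maps R M N \<Longrightarrow> x \<in> carrier M \<Longrightarrow> f x \<in> carrier N"
  by (auto simp: linear_maps_def)

lemma linear_maps_add:
  "f \<in> linear_maps R M N \<Longrightarrow> x \<in> carrier M \<Longrightarrow> y \<in> carrier M \<Longrightarrow>
    f (x \<oplus>\<^bsub>M\<^esub> y) = f x \<oplus>\<^bsub>N\<^esub> f y"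
  by (simp add: linear_maps_def)

lemma linear_maps_smult:
  "f \<in> linear_maps R M N \<Longrightarrow> a \<in> carrier R \<Longrightarrow> x \<in> carrier M \<Longrightarrow>
    f (a \<odot>\<^bsub>M\<^esub> x) = a \<odot>\<^bsub>N\<^esub> f x"
  by (simp add: linear_maps_def)

text \<open>Additivity alone suffices once \<open>x\<close> is split as \<open>(x - y) + y\<close>;
  the image of \<open>y\<close> is then cancelled in \<open>N\<close>.\<close>

lemma linear_maps_diff:
  assumes "module R M" "module R N" and f: "f \<in> linear_maps R M N"
    and x: "x \<in> carrier M" and y: "y \<in> carrier M"
  shows "f (x \<ominus>\<^bsub>M\<^esub> y) = f x \<ominus>\<^bsub>N\<^esub> f y"
proof -
  interpret M: module R M by fact
  interpret N: module R N by fact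
  note c = linear_maps_closed[OF f]
  have "f x = f ((x \<ominus>\<^bsub>M\<^esub> y) \<oplus>\<^bsub>M\<^esub> y)"
    using x y by (simp add: a_minus_def M.M.a_assoc M.M.l_neg)
  also have "\<dots> = f (x \<ominus>\<^bsub>M\<^esub> y) \<oplus>\<^bsub>N\<^esub> f y"
    using x y by (simp add: linear_maps_add[OF f])
  finally show ?thesis
    using c x y by (simp add: a_minus_def N.M.a_assoc N.M.r_neg)
qed

lemma linear_maps_id: "id \<in> linear_maps R M M"
  by (simp add: linear_maps_def)

lemma linear_maps_comp:
  "f \<in> linear_maps R M N \<Longrightarrow> g \<in> linear_maps R N P \<Longrightarrow> (\<lambda>x. g (f x)) \<in> linear_maps R M P"
  by (auto simp: linear_maps_def Pi_iff)

lemma (in abelian_group) add_diff_distrib: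
  assumes "x \<in> carrier G" "y \<in> carrier G" "z \<in> carrier G" "w \<in> carrier G"
  shows "(x \<oplus> y) \<ominus> (z \<oplus> w) = (x \<ominus> z) \<oplus> (y \<ominus> w)"
  using assms by (simp add: a_minus_def minus_add a_ac)

lemma (in module) smult_diff:
  assumes "a \<in> carrier R" "x \<in> carrier M" "y \<in> carrier M"
  shows "a \<odot>\<^bsub>M\<^esub> (x \<ominus>\<^bsub>M\<^esub> y) = a \<odot>\<^bsub>M\<^esub> x \<ominus>\<^bsub>M\<^esub> a \<odot>\<^bsub>M\<^esub> y"
  using assms by (simp add: a_minus_def smult_r_distr smult_r_minus)

lemma linear_maps_minus:
  assumes "module R N" "f \<in> linear_maps R M N" "g \<in> linear_maps R M N"
  shows "(\<lambda>x. f x \<ominus>\<^bsub>N\<^esub> g x) \<in> linear_maps R M N"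
proof -
  interpret N: module R N by fact
  show ?thesis
    using assms(2,3) by (auto simp: linear_maps_def Pi_iff N.M.add_diff_distrib N.smult_diff)
qed

lemma bilinear_mapsI:
  assumes "\<And>x. x \<in> carrier M \<Longrightarrow> b x \<in> linear_maps R N P"
    and "\<And>y. y \<in> carrier N \<Longrightarrow> (\<lambda>x. b x y) \<in> linear_maps R M P"
  shows "b \<in> bilinear_maps R M N P"
  using assms by (simp add: bilinear_maps_def)

section \<open>Pure tensors and the universal property\<close>

lemma tensor_module:
  assumes "module R M" "module R N"
  shows "module R (tensor R M N)"
proof -
  interpret two_modules R M N using assms by (simp add: two_modules_def)
  show ?thesis unfolding tensor_def by (rule L.quotient_module_module[OF kernel_submodule])
qed

lemma pure_tensor_linear:
  assumes "module R M" "module R N"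
  shows pure_tensor_linear_left:
      "y \<in> carrier N \<Longrightarrow> (\<lambda>x. pure_tensor R M N x y) \<in> linear_maps R M (tensor R M N)"
    and pure_tensor_linear_right:
      "x \<in> carrier M \<Longrightarrow> pure_tensor R M N x \<in> linear_maps R N (tensor R M N)"
proof -
  interpret two_modules R M N using assms by (simp add: two_modules_def)
  show "y \<in> carrier N \<Longrightarrow> (\<lambda>x. pure_tensor R M N x y) \<in> linear_maps R M (tensor R M N)"
    "x \<in> carrier M \<Longrightarrow> pure_tensor R M N x \<in> linear_maps R N (tensor R M N)"
    using pure_bilinear by (auto simp: bilinear_maps_def)
qed

lemma pure_tensor_closed:
  assumes "module R M" "module R N" "x \<in> carrier M" "y \<in> carrier N"
  shows "pure_tensor R M N x y \<in> carrier (tensor R M N)"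
  by (rule linear_maps_closed[OF pure_tensor_linear_right[OF assms(1-3)] assms(4)])

lemma tensor_eqI:
  assumes "module R M" "module R N" "module R P"
    and "f \<in> linear_maps R (tensor R M N) P" "g \<in> linear_maps R (tensor R M N) P"
    and "\<And>x y. x \<in> carrier M \<Longrightarrow> y \<in> carrier N \<Longrightarrow>
      f (pure_tensor R M N x y) = g (pure_tensor R M N x y)"
    and "t \<in> carrier (tensor R M N)"
  shows "f t = g t"
proof -
  interpret two_modules R M N using assms by (simp add: two_modules_def)
  show ?thesis using tensor_ext[OF assms(3-7)] .
qed

text \<open>For a fixed third factor \<open>z\<close> both maps become linear in the first factor
  \<open>s\<close>, so \<open>tensor_eqI\<close> applies twice: once to reduce to
  \<open>s \<otimes> z\<close>, once to reduce \<open>s\<close> to a pure tensor.\<close>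

lemma tensor_eqI3:
  assumes M: "module R M" and N: "module R N" and P: "module R P" and Q: "module R Q"
    and f: "f \<in> linear_maps R (tensor R (tensor R M N) P) Q"
    and g: "g \<in> linear_maps R (tensor R (tensor R M N) P) Q"
    and eq: "\<And>x y z. x \<in> carrier M \<Longrightarrow> y \<in> carrier N \<Longrightarrow> z \<in> carrier P \<Longrightarrow>
      f (pure_tensor R (tensor R M N) P (pure_tensor R M N x y) z) =
      g (pure_tensor R (tensor R M N) P (pure_tensor R M N x y) z)"
    and t: "t \<in> carrier (tensor R (tensor R M N) P)"
  shows "f t = g t"
proof (rule tensor_eqI[OF tensor_module[OF M N] P Q f g _ t])
  fix s z assume s: "s \<in> carrier (tensor R M N)" and z: "z \<in> carrier P"
  note p = pure_tensor_linear_left[OF tensor_module[OF M N] P z]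
  show "f (pure_tensor R (tensor R M N) P s z) = g (pure_tensor R (tensor R M N) P s z)"
    by (rule tensor_eqI[OF M N Q linear_maps_comp[OF p f] linear_maps_comp[OF p g] eq s])
      (use z in auto)
qed

text \<open>Unique existence in \<open>tensor_universal\<close> makes the definite description in
  \<open>tensor_lift_def\<close> meaningful. From here on lifts are used only through linearity and
  their values on pure tensors.\<close>

lemma tensor_lift:
  assumes "module R M" "module R N" "module R P" "b \<in> bilinear_maps R M N P"
  shows tensor_lift_linear: "tensor_lift R M N P b \<in> linear_maps R (tensor R M N) P"
    and tensor_lift_pure: "x \<in> carrier M \<Longrightarrow> y \<in> carrier N \<Longrightarrow>
      tensor_lift R M N P b (pure_tensor R M N x y) = b x y"
proof -
  interpret two_modules R M N using assms by (simp add: two_modules_def)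
  note h = theI'[OF tensor_universal[OF assms(3,4)], folded tensor_lift_def]
  show "tensor_lift R M N P b \<in> linear_maps R (tensor R M N) P" using h by blast
  show "x \<in> carrier M \<Longrightarrow> y \<in> carrier N \<Longrightarrow>
      tensor_lift R M N P b (pure_tensor R M N x y) = b x y" using h by blast
qed

section \<open>Maps between tensor products: \<open>f \<otimes> g\<close>, exchange and
  reassociation\<close>

lemma tensor_map:
  assumes M: "module R M" and N: "module R N" and M': "module R M'" and N': "module R N'"
    and f: "f \<in> linear_maps R M M'" and g: "g \<in> linear_maps R N N'"
  shows tensor_map_linear:
      "tensor_map R M N M' N' f g \<in> linear_maps R (tensor R M N) (tensor R M' N')"
    and tensor_map_pure: "x \<in> carrier M \<Longrightarrow> y \<in> carrier N \<Longrightarrow>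
      tensor_map R M N M' N' f g (pure_tensor R M N x y) = pure_tensor R M' N' (f x) (g y)"
proof -
  have b: "(\<lambda>x y. pure_tensor R M' N' (f x) (g y)) \<in> bilinear_maps R M N (tensor R M' N')"
    by (intro bilinear_mapsI linear_maps_comp[OF g] linear_maps_comp[OF f]
        pure_tensor_linear_left pure_tensor_linear_right M' N'
        linear_maps_closed[OF f] linear_maps_closed[OF g])
  note l = tensor_lift[OF M N tensor_module[OF M' N'] b, folded tensor_map_def]
  show "tensor_map R M N M' N' f g \<in> linear_maps R (tensor R M N) (tensor R M' N')" by (rule l(1))
  show "x \<in> carrier M \<Longrightarrow> y \<in> carrier N \<Longrightarrow>
      tensor_map R M N M' N' f g (pure_tensor R M N x y) = pure_tensor R M' N' (f x) (g y)"
    by (rule l(2))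
qed

text \<open>On pure tensors this is linearity of \<open>\<otimes>\<close> in its left argument. It
  serves to split \<open>\<Delta> \<otimes> \<alpha>\<close> along the two summands of
  \<open>\<Delta>\<close>.\<close>

lemma tensor_map_diff_left:
  assumes M: "module R M" and N: "module R N" and M': "module R M'" and N': "module R N'"
    and f: "f \<in> linear_maps R M M'" and f': "f' \<in> linear_maps R M M'"
    and g: "g \<in> linear_maps R N N'" and t: "t \<in> carrier (tensor R M N)"
  shows "tensor_map R M N M' N' (\<lambda>x. f x \<ominus>\<^bsub>M'\<^esub> f' x) g t =
    tensor_map R M N M' N' f g t \<ominus>\<^bsub>tensor R M' N'\<^esub> tensor_map R M N M' N' f' g t"
proof (rule tensor_eqI[OF M N tensor_module[OF M' N'] _ _ _ t])
  note ff = linear_maps_minus[OF M' f f']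
  note lin = tensor_map_linear[OF M N M' N' _ g] and pure = tensor_map_pure[OF M N M' N' _ g]
  show "tensor_map R M N M' N' (\<lambda>x. f x \<ominus>\<^bsub>M'\<^esub> f' x) g
      \<in> linear_maps R (tensor R M N) (tensor R M' N')"
    by (rule lin[OF ff])
  show "(\<lambda>t. tensor_map R M N M' N' f g t \<ominus>\<^bsub>tensor R M' N'\<^esub> tensor_map R M N M' N' f' g t)
      \<in> linear_maps R (tensor R M N) (tensor R M' N')"
    by (rule linear_maps_minus[OF tensor_module[OF M' N'] lin[OF f] lin[OF f']])
  fix x y assume x: "x \<in> carrier M" and y: "y \<in> carrier N"
  show "tensor_map R M N M' N' (\<lambda>x. f x \<ominus>\<^bsub>M'\<^esub> f' x) g (pure_tensor R M N x y) =
    tensor_map R M N M' N' f g (pure_tensor R M N x y) \<ominus>\<^bsub>tensor R M' N'\<^esub>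
    tensor_map R M N M' N' f' g (pure_tensor R M N x y)"
    using linear_maps_diff[OF M' tensor_module[OF M' N'] pure_tensor_linear_left[OF M' N'
          linear_maps_closed[OF g y]] linear_maps_closed[OF f x] linear_maps_closed[OF f' x]]
    by (simp add: pure[OF f x y] pure[OF f' x y] pure[OF ff x y])
qed

lemma tensor_swap:
  assumes M: "module R M" and N: "module R N"
  shows tensor_swap_linear:
      "tensor_swap R M N \<in> linear_maps R (tensor R M N) (tensor R N M)"
    and tensor_swap_pure: "x \<in> carrier M \<Longrightarrow> y \<in> carrier N \<Longrightarrow>
      tensor_swap R M N (pure_tensor R M N x y) = pure_tensor R N M y x"
proof -
  have b: "(\<lambda>x y. pure_tensor R N M y x) \<in> bilinear_maps R M N (tensor R N M)"
    by (intro bilinear_mapsI pure_tensor_linear_left pure_tensor_linear_right M N)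
  note l = tensor_lift[OF M N tensor_module[OF N M] b, folded tensor_swap_def]
  show "tensor_swap R M N \<in> linear_maps R (tensor R M N) (tensor R N M)" by (rule l(1))
  show "x \<in> carrier M \<Longrightarrow> y \<in> carrier N \<Longrightarrow>
      tensor_swap R M N (pure_tensor R M N x y) = pure_tensor R N M y x"
    by (rule l(2))
qed

lemma tensor_swap_swap:
  assumes M: "module R M" and N: "module R N" and t: "t \<in> carrier (tensor R M N)"
  shows "tensor_swap R N M (tensor_swap R M N t) = t"
proof -
  have "tensor_swap R N M (tensor_swap R M N t) = id t"
    by (rule tensor_eqI[OF M N tensor_module[OF M N] linear_maps_comp[OF
            tensor_swap_linear[OF M N] tensor_swap_linear[OF N M]] linear_maps_id _ t])
      (simp add: tensor_swap_pure M N)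
  then show ?thesis by simp
qed

text \<open>The map is a lift whose values are themselves lifts, so bilinearity is needed at two
  levels: in \<open>y\<close> and \<open>z\<close> for each fixed \<open>x\<close>, and then in
  \<open>x\<close> and an arbitrary \<open>t\<close> in \<open>N \<otimes> P\<close>.\<close>

lemma tensor_assoc:
  assumes M: "module R M" and N: "module R N" and P: "module R P"
  shows tensor_assoc_linear: "tensor_assoc R M N P \<in>
      linear_maps R (tensor R M (tensor R N P)) (tensor R (tensor R M N) P)"
    and tensor_assoc_pure: "x \<in> carrier M \<Longrightarrow> y \<in> carrier N \<Longrightarrow> z \<in> carrier P \<Longrightarrow>
      tensor_assoc R M N P (pure_tensor R M (tensor R N P) x (pure_tensor R N P y z)) =
      pure_tensor R (tensor R M N) P (pure_tensor R M N x y) z"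
proof -
  let ?MN = "tensor R M N" and ?NP = "tensor R N P"
  let ?T = "tensor R ?MN P"
  let ?p = "\<lambda>x y z. pure_tensor R ?MN P (pure_tensor R M N x y) z"
  let ?l = "\<lambda>x. tensor_lift R N P ?T (?p x)"
  note MN = tensor_module[OF M N] and NP = tensor_module[OF N P]
  note T = tensor_module[OF MN P]
  interpret T: module R ?T by (rule T)
  have inner: "?p x \<in> bilinear_maps R N P ?T" if x: "x \<in> carrier M" for x
    by (intro bilinear_mapsI pure_tensor_linear_right[OF MN P] pure_tensor_closed[OF M N x]
        linear_maps_comp[OF pure_tensor_linear_right[OF M N x]] pure_tensor_linear_left[OF MN P])
  note lin = tensor_lift_linear[OF N P T inner] and pure = tensor_lift_pure[OF N P T inner]
  have p_lin: "(\<lambda>x. ?p x y z) \<in> linear_maps R M ?T" if "y \<in> carrier N" "z \<in> carrier P" for y z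
    by (rule linear_maps_comp[OF pure_tensor_linear_left[OF M N] pure_tensor_linear_left[OF MN P]])
      (use that in auto)
  have outer: "?l \<in> bilinear_maps R M ?NP ?T"
  proof (rule bilinear_mapsI)
    fix t assume t: "t \<in> carrier ?NP"
    \<comment> \<open>Since \<open>t\<close> need not be pure, the value of the inner lift at
      \<open>t\<close> is not explicit. Both sides are linear in \<open>t\<close>, however, and on
      pure tensors the claim is linearity of \<open>?p\<close> in \<open>x\<close>.\<close>
    have add: "?l (x \<oplus>\<^bsub>M\<^esub> x') t = ?l x t \<oplus>\<^bsub>?T\<^esub> ?l x' t"
      if x: "x \<in> carrier M" and x': "x' \<in> carrier M" for x x'
    proof (rule tensor_eqI[OF N P T lin _ _ t])
      show xx: "x \<oplus>\<^bsub>M\<^esub> x' \<in> carrier M"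
        using x x' by (rule abelian_monoid.a_closed[OF abelian_group.axioms(1)[OF module.axioms(2)[OF M]]])
      show "(\<lambda>t. ?l x t \<oplus>\<^bsub>?T\<^esub> ?l x' t) \<in> linear_maps R ?NP ?T"
        using lin[OF x] lin[OF x']
        by (auto simp: linear_maps_def Pi_iff T.M.a_ac T.smult_r_distr)
      show "?l (x \<oplus>\<^bsub>M\<^esub> x') (pure_tensor R N P y z) =
          ?l x (pure_tensor R N P y z) \<oplus>\<^bsub>?T\<^esub> ?l x' (pure_tensor R N P y z)"
        if "y \<in> carrier N" "z \<in> carrier P" for y z
        using pure[OF x that] pure[OF x' that] pure[OF xx that] linear_maps_add[OF p_lin[OF that] x x']
        by simp
    qed
    have smult: "?l (a \<odot>\<^bsub>M\<^esub> x) t = a \<odot>\<^bsub>?T\<^esub> ?l x t"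
      if a: "a \<in> carrier R" and x: "x \<in> carrier M" for a x
    proof (rule tensor_eqI[OF N P T lin _ _ t])
      show ax: "a \<odot>\<^bsub>M\<^esub> x \<in> carrier M" using a x by (rule module.smult_closed[OF M])
      \<comment> \<open>A scalar multiple of a linear map is linear because \<open>R\<close> is
        commutative.\<close>
      show "(\<lambda>t. a \<odot>\<^bsub>?T\<^esub> ?l x t) \<in> linear_maps R ?NP ?T"
        using lin[OF x] a T.smult_assoc1[symmetric]
        by (auto simp: linear_maps_def Pi_iff T.smult_r_distr T.R.m_comm)
      show "?l (a \<odot>\<^bsub>M\<^esub> x) (pure_tensor R N P y z) = a \<odot>\<^bsub>?T\<^esub> ?l x (pure_tensor R N P y z)"
        if "y \<in> carrier N" "z \<in> carrier P" for y z
        using pure[OF x that] pure[OF ax that] linear_maps_smult[OF p_lin[OF that] a x] by simp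
    qed
    show "(\<lambda>x. ?l x t) \<in> linear_maps R M ?T"
      using add smult linear_maps_closed[OF lin t] by (simp add: linear_maps_def)
  qed (rule lin)
  note l = tensor_lift[OF M NP T outer, folded tensor_assoc_def]
  show "tensor_assoc R M N P \<in> linear_maps R (tensor R M ?NP) ?T" by (rule l(1))
  show "tensor_assoc R M N P (pure_tensor R M ?NP x (pure_tensor R N P y z)) = ?p x y z"
    if "x \<in> carrier M" "y \<in> carrier N" "z \<in> carrier P"
    using l(2)[OF that(1) pure_tensor_closed[OF N P that(2,3)]] pure[OF that] by simp
qed

section \<open>The operators \<open>\<sigma>\<close> and \<open>\<kappa>\<close> on the threefold
  tensor product\<close>

context vector_space_char_0
begin

text \<open>This is \<open>\<sigma>\<close>, written exactly as the operator
  \<open>\<tau> \<otimes> I\<close> of \<open>prelie_axiom\<close>, so that unfolding it gives the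
  required identity.\<close>

definition flip where "flip = tensor_map F CC C CC C (tensor_swap F C C) id"

text \<open>This is \<open>\<kappa>\<close>: exchange the pair with the third factor, then
  reassociate. Ending with \<open>tensor_assoc\<close> matches the shape of
  \<open>tensor_right\<close> and stays inside \<open>(C \<otimes> C) \<otimes> C\<close>.\<close>

definition rotate3 where "rotate3 t = tensor_assoc F C C C (tensor_swap F CC C t)"

lemmas C_module = module_axioms
lemmas CC_module = tensor_module[OF C_module C_module]
lemmas CCC_module = tensor_module[OF CC_module C_module]
lemmas swap_linear = tensor_swap_linear[OF C_module C_module]
lemmas swap_pure = tensor_swap_pure[OF C_module C_module]
lemmas CC_pure_closed = pure_tensor_closed[OF C_module C_module]

lemma flip_linear: "flip \<in> linear_maps F CCC CCC"
  unfolding flip_def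
  by (rule tensor_map_linear[OF CC_module C_module CC_module C_module swap_linear linear_maps_id])

lemma rotate_linear: "rotate3 \<in> linear_maps F CCC CCC"
  unfolding rotate3_def
  by (rule linear_maps_comp[OF tensor_swap_linear[OF CC_module C_module]
      tensor_assoc_linear[OF C_module C_module C_module]])

text \<open>The first factor \<open>u\<close> is left arbitrary because it will be a value of
  \<open>D\<close>, which is in general not a pure tensor.\<close>

lemma flip_pure:
  assumes "u \<in> carrier CC" "z \<in> carrier C"
  shows "flip (pure_tensor F CC C u z) = pure_tensor F CC C (tensor_swap F C C u) z"
  unfolding flip_def
  using tensor_map_pure[OF CC_module C_module CC_module C_module swap_linear linear_maps_id assms]
  by simp

lemma rotate_pure:
  assumes "x \<in> carrier C" "y \<in> carrier C" "z \<in> carrier C"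
  shows "rotate3 (pure_tensor F CC C (pure_tensor F C C x y) z) =
    pure_tensor F CC C (pure_tensor F C C z x) y"
  using assms
  by (simp add: rotate3_def tensor_swap_pure[OF CC_module C_module] CC_pure_closed
      tensor_assoc_pure[OF C_module C_module C_module])

lemmas flip_pure_pure = flip_pure[OF CC_pure_closed]

lemma flip_flip: "t \<in> carrier CCC \<Longrightarrow> flip (flip t) = t"
  using tensor_eqI3[OF C_module C_module C_module CCC_module
      linear_maps_comp[OF flip_linear flip_linear] linear_maps_id, of t]
  by (simp add: flip_pure_pure swap_pure)

lemma rotate_rotate_rotate: "t \<in> carrier CCC \<Longrightarrow> rotate3 (rotate3 (rotate3 t)) = t"
  using tensor_eqI3[OF C_module C_module C_module CCC_module
      linear_maps_comp[OF linear_maps_comp[OF rotate_linear rotate_linear] rotate_linear]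
      linear_maps_id, of t]
  by (simp add: rotate_pure)

text \<open>Follow \<open>x \<otimes> y \<otimes> z\<close> to
  \<open>z \<otimes> x \<otimes> y\<close>, to \<open>x \<otimes> z \<otimes> y\<close>, to
  \<open>y \<otimes> x \<otimes> z\<close>. This removes rotations standing on both sides of a
  flip.\<close>

lemma rotate_flip_rotate: "t \<in> carrier CCC \<Longrightarrow> rotate3 (flip (rotate3 t)) = flip t"
  using tensor_eqI3[OF C_module C_module C_module CCC_module
      linear_maps_comp[OF linear_maps_comp[OF rotate_linear flip_linear] rotate_linear]
      flip_linear, of t]
  by (simp add: rotate_pure flip_pure_pure swap_pure)

section \<open>The products \<open>D \<otimes> \<alpha>\<close> and
  \<open>\<alpha> \<otimes> D\<close> in terms of \<open>\<sigma>\<close> and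
  \<open>\<kappa>\<close>\<close>

context
  fixes \<alpha> assumes \<alpha>: "\<alpha> \<in> linear_maps F C C"
begin

lemma tensor_left_linear:
  "D \<in> linear_maps F C CC \<Longrightarrow> tensor_left D \<alpha> \<in> linear_maps F CC CCC"
  using tensor_map_linear[OF C_module C_module CC_module C_module _ \<alpha>] .

text \<open>At \<open>x \<otimes> y\<close> both sides are
  \<open>\<tau> (D x) \<otimes> \<alpha> y\<close>.\<close>

lemma tensor_left_swap:
  assumes D: "D \<in> linear_maps F C CC" and t: "t \<in> carrier CC"
  shows "tensor_left (\<lambda>c. tensor_swap F C C (D c)) \<alpha> t = flip (tensor_left D \<alpha> t)"
proof -
  note D' = linear_maps_comp[OF D swap_linear]
  note pure = tensor_map_pure[OF C_module C_module CC_module C_module _ \<alpha>]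
  show ?thesis
    by (rule tensor_eqI[OF C_module C_module CCC_module tensor_left_linear[OF D']
          linear_maps_comp[OF tensor_left_linear[OF D] flip_linear] _ t])
      (simp add: pure[OF D] pure[OF D'] flip_pure linear_maps_closed[OF D] linear_maps_closed[OF \<alpha>])
qed

text \<open>At \<open>x \<otimes> y\<close> the right side passes through
  \<open>y \<otimes> x\<close> and \<open>D y \<otimes> \<alpha> x\<close>; exchanging gives
  \<open>\<alpha> x \<otimes> D y\<close>, and the same reassociation as on the left follows. As
  \<open>D y\<close> need not be pure, \<open>rotate3\<close> is unfolded instead of evaluated by
  \<open>rotate_pure\<close>.\<close>

lemma tensor_right_eq_rotate:
  assumes D: "D \<in> linear_maps F C CC" and t: "t \<in> carrier CC"
  shows "tensor_right \<alpha> D t = rotate3 (tensor_left D \<alpha> (tensor_swap F C C t))"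
proof (rule tensor_eqI[OF C_module C_module CCC_module _ _ _ t])
  note mr = tensor_map[OF C_module C_module C_module CC_module \<alpha> D]
  show "tensor_right \<alpha> D \<in> linear_maps F CC CCC"
    unfolding comp_def
    by (rule linear_maps_comp[OF mr(1) tensor_assoc_linear[OF C_module C_module C_module]])
  show "(\<lambda>t. rotate3 (tensor_left D \<alpha> (tensor_swap F C C t))) \<in> linear_maps F CC CCC"
    by (rule linear_maps_comp[OF linear_maps_comp[OF swap_linear tensor_left_linear[OF D]]
          rotate_linear])
  show "tensor_right \<alpha> D (pure_tensor F C C x y) =
      rotate3 (tensor_left D \<alpha> (tensor_swap F C C (pure_tensor F C C x y)))"
    if "x \<in> carrier C" "y \<in> carrier C" for x y
    using that
    by (simp add: mr(2) swap_pure tensor_map_pure[OF C_module C_module CC_module C_module D \<alpha>]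
        rotate3_def tensor_swap_pure[OF CC_module C_module] linear_maps_closed[OF D]
        linear_maps_closed[OF \<alpha>])
qed

end

end

section \<open>The coassociator of \<open>\<Delta>\<close>\<close>

text \<open>Primed elements will be images under \<open>\<sigma>\<close>; in the application
  \<open>g\<close> and \<open>g'\<close> are \<open>\<kappa> p \<Delta>\<^sub>-\<^sub>1\<close> and its image.\<close>

lemma (in abelian_group) prelie_cancellation:
  assumes [simp]: "a \<in> carrier G" "a' \<in> carrier G" "b \<in> carrier G" "e \<in> carrier G"
    "e' \<in> carrier G" "f \<in> carrier G" "g \<in> carrier G" "g' \<in> carrier G"
  shows "((b \<ominus> a') \<ominus> (e \<ominus> f)) \<ominus> (((a \<oplus> b) \<ominus> g') \<ominus> (g \<ominus> (e' \<oplus> f))) =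
    (g \<ominus> a \<ominus> e) \<oplus> (g' \<ominus> a' \<ominus> e')" (is "?l = ?r")
proof -
  \<comment> \<open>Expanding \<open>?l\<close> gives the six summands of \<open>?r\<close> and, in
    addition, \<open>b\<close> and \<open>f\<close> with both signs. Spelling out these pairs makes
    both sides sums of the same ten terms, equal up to order; the cancellation rules are withheld
    until then.\<close>
  have "?l = ?r \<oplus> ((b \<oplus> \<ominus> b) \<oplus> (f \<oplus> \<ominus> f))"
    by (simp add: a_minus_def minus_add a_ac del: r_neg l_neg)
  then show ?thesis by (simp add: r_neg)
qed

context hom_dendriform_coalgebra
begin

lemma prelie:
  assumes c: "c \<in> carrier C"
  defines "D \<equiv> \<lambda>c. Dp c \<ominus>\<^bsub>CC\<^esub> tensor_swap F C C (Dm c)"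
  shows "D \<in> linear_maps F C CC"
    and "tensor_left D \<alpha> (D c) \<ominus>\<^bsub>CCC\<^esub> tensor_right \<alpha> D (D c) =
      flip (tensor_left D \<alpha> (D c) \<ominus>\<^bsub>CCC\<^esub> tensor_right \<alpha> D (D c))"
proof -
  interpret CCC: module F CCC by (rule CCC_module)
  let ?\<tau> = "tensor_swap F C C" and ?m = "tensor_left Dm \<alpha>" and ?p = "tensor_left Dp \<alpha>"
  note Dm' = linear_maps_comp[OF Dm_linear swap_linear]
  show D: "D \<in> linear_maps F C CC"
    unfolding D_def by (rule linear_maps_minus[OF CC_module Dp_linear Dm'])
  note left = tensor_left_linear[OF alpha_linear]
  note cl [simp] = linear_maps_closed[OF Dm_linear c] linear_maps_closed[OF Dp_linear c]
    linear_maps_closed[OF swap_linear] linear_maps_closed[OF flip_linear]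
    linear_maps_closed[OF rotate_linear] linear_maps_closed[OF left[OF Dm_linear]]
    linear_maps_closed[OF left[OF Dp_linear]] linear_maps_closed[OF left[OF D]]
    tensor_swap_swap[OF C_module C_module]
  note diff = linear_maps_diff[OF CCC_module CCC_module]
  note rotate_diff = diff[OF rotate_linear] and flip_diff = diff[OF flip_linear]
  note right = tensor_right_eq_rotate[OF alpha_linear]
  have left_D: "tensor_left D \<alpha> t = ?p t \<ominus>\<^bsub>CCC\<^esub> flip (?m t)" if t: "t \<in> carrier CC" for t
    unfolding D_def
    using tensor_map_diff_left[OF C_module C_module CC_module C_module Dp_linear Dm' alpha_linear t]
      tensor_left_swap[OF alpha_linear Dm_linear t] by simp
  \<comment> \<open>Applying \<open>?m\<close> and \<open>?p\<close> to \<open>Dm c\<close>,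
    \<open>Dp c\<close> and their images under \<open>?\<tau>\<close> gives eight elements. These
    are five of them; the three axioms eliminate the others, \<open>?m (Dm c)\<close>,
    \<open>?m (?\<tau> (Dp c))\<close> and \<open>?p (?\<tau> (Dp c))\<close>.\<close>
  define a b e f g where "a = ?m (Dp c)" and "b = ?p (Dp c)" and "e = ?p (?\<tau> (Dm c))"
    and "f = ?m (?\<tau> (Dm c))" and "g = ?p (Dm c)"
  note defs = a_def b_def e_def f_def g_def
  have [simp]: "a \<in> carrier CCC" "b \<in> carrier CCC" "e \<in> carrier CCC" "f \<in> carrier CCC"
    "g \<in> carrier CCC" by (simp_all add: defs)
  \<comment> \<open>Here and in the next two steps \<open>comp_apply\<close> is withheld so that
    \<open>tensor_right\<close> remains a composite which \<open>right\<close> can rewrite.\<close>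
  have mm: "?m (Dm c) = rotate3 f \<oplus>\<^bsub>CCC\<^esub> rotate3 e"
    using left_axiom[OF c] by (simp add: right Dm_linear Dp_linear defs del: comp_apply)
  have g: "g = rotate3 (?m (?\<tau> (Dp c)))"
    using middle_axiom[OF c] by (simp add: right Dm_linear defs del: comp_apply)
  have pp: "rotate3 (?p (?\<tau> (Dp c))) = a \<oplus>\<^bsub>CCC\<^esub> b"
    using right_axiom[OF c] by (simp add: right Dp_linear defs del: comp_apply)
  \<comment> \<open>The middle axiom is solved for \<open>?m (?\<tau> (Dp c))\<close> by means of
    \<open>\<kappa>\<^sup>3 = 1\<close>. Its image under \<open>\<kappa> \<sigma>\<close> is then
    \<open>\<kappa> \<sigma> \<kappa>\<close> at \<open>rotate3 g\<close>, hence
    \<open>flip (rotate3 g)\<close>.\<close>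
  have "rotate3 (rotate3 g) = ?m (?\<tau> (Dp c))"
    by (simp add: g rotate_rotate_rotate)
  then have mp: "rotate3 (flip (?m (?\<tau> (Dp c)))) = flip (rotate3 g)"
    by (metis \<open>g \<in> carrier CCC\<close> cl(5) rotate_flip_rotate)
  have fe: "rotate3 (flip (?m (Dm c))) = flip e \<oplus>\<^bsub>CCC\<^esub> flip f"
    by (simp add: mm linear_maps_add[OF flip_linear] linear_maps_add[OF rotate_linear]
        rotate_flip_rotate CCC.M.a_comm)
  have Dc: "D c = Dp c \<ominus>\<^bsub>CC\<^esub> ?\<tau> (Dm c)" by (simp add: D_def)
  have l: "tensor_left D \<alpha> (D c) =
      (b \<ominus>\<^bsub>CCC\<^esub> flip a) \<ominus>\<^bsub>CCC\<^esub> (e \<ominus>\<^bsub>CCC\<^esub> flip f)"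
    using linear_maps_diff[OF CC_module CCC_module left[OF D], of "Dp c" "?\<tau> (Dm c)"]
    by (simp add: Dc left_D defs)
  \<comment> \<open>Rewriting \<open>\<alpha> \<otimes> \<Delta>\<close> through
    \<open>\<kappa>\<close> calls for \<open>\<tau> \<Delta>\<close>, and
    \<open>\<tau> \<tau> = 1\<close> turns its second term into \<open>Dm c\<close> itself.\<close>
  have "?\<tau> (D c) = ?\<tau> (Dp c) \<ominus>\<^bsub>CC\<^esub> Dm c"
    using linear_maps_diff[OF CC_module CC_module swap_linear, of "Dp c" "?\<tau> (Dm c)"]
    by (simp add: Dc)
  then have "tensor_right \<alpha> D (D c) =
      rotate3 (tensor_left D \<alpha> (?\<tau> (Dp c)) \<ominus>\<^bsub>CCC\<^esub> tensor_left D \<alpha> (Dm c))"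
    using right[OF D linear_maps_closed[OF D c]]
      linear_maps_diff[OF CC_module CCC_module left[OF D], of "?\<tau> (Dp c)" "Dm c"]
    by simp
  also have "\<dots> = ((a \<oplus>\<^bsub>CCC\<^esub> b) \<ominus>\<^bsub>CCC\<^esub> flip (rotate3 g)) \<ominus>\<^bsub>CCC\<^esub>
      (rotate3 g \<ominus>\<^bsub>CCC\<^esub> (flip e \<oplus>\<^bsub>CCC\<^esub> flip f))"
    by (simp add: left_D rotate_diff pp mp fe g_def[symmetric])
  finally have r: "tensor_right \<alpha> D (D c) = \<dots>" .
  \<comment> \<open>In the difference of \<open>l\<close> and \<open>r\<close> the terms
    \<open>b\<close> and \<open>flip f\<close> occur with opposite signs. What survives is three
    elements and their flips; \<open>y\<close> collects the unflipped ones. In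
    \<open>prelie_cancellation\<close> the role of \<open>f\<close> is played by
    \<open>flip f\<close>.\<close>
  define y where "y = rotate3 g \<ominus>\<^bsub>CCC\<^esub> a \<ominus>\<^bsub>CCC\<^esub> e"
  have y: "y \<in> carrier CCC" by (simp add: y_def)
  have "tensor_left D \<alpha> (D c) \<ominus>\<^bsub>CCC\<^esub> tensor_right \<alpha> D (D c) = y \<oplus>\<^bsub>CCC\<^esub> flip y"
    unfolding l r y_def by (simp add: CCC.M.prelie_cancellation flip_diff)
  then show "tensor_left D \<alpha> (D c) \<ominus>\<^bsub>CCC\<^esub> tensor_right \<alpha> D (D c) =
      flip (tensor_left D \<alpha> (D c) \<ominus>\<^bsub>CCC\<^esub> tensor_right \<alpha> D (D c))"
    using y by (simp add: linear_maps_add[OF flip_linear] flip_flip CCC.M.a_comm)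
qed

end

theorem proposition3p13:
  fixes F :: "('f, 'r) ring_scheme"
    and C :: "('f, 'c, 'm) module_scheme"
    and Dm Dp :: "'c \<Rightarrow> ('c \<times> 'c \<Rightarrow> 'f) set"
    and \<alpha> :: "'c \<Rightarrow> 'c"
  assumes "hom_dendriform_coalgebra F C Dm Dp \<alpha>"
  shows "hom_prelie_coalgebra F C (\<lambda>c. Dp c \<ominus>\<^bsub>tensor F C C\<^esub> tensor_swap F C C (Dm c)) \<alpha>"
proof -
  interpret hom_dendriform_coalgebra F C Dm Dp \<alpha> by fact
  show ?thesis
    \<comment> \<open>Both facts in \<open>prelie\<close> are stated for an element \<open>c\<close>
      of the carrier; for linearity of \<open>D\<close> the zero of \<open>C\<close> serves as that
      element.\<close>
    by unfold_locales (use prelie alpha_linear M.zero_closed in \<open>auto simp: flip_def\<close>)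
qed

end
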